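(* For any finite $\mathbf{A} \in \mathsf{CIdInRL}$, $\langle A, \sqsubseteq \rangle$ is a distributive semilattice.
   Context: A commutative idempotent involutive residuated lattice is an algebra $\mathbf{A}=\langle A,\wedge,\vee,\cdot,\to,1,0\rangle$ such that $\langle A,\wedge,\vee\rangle$ is a lattice (with lattice order $\leq$), $\langle A,\cdot,1\rangle$ is a commutative monoid with $x\cdot x=x$ for all $x$, residuation holds ($x\cdot y\leq z \iff y\leq x\to z$), and, writing $-x := x\to 0$, one has $-{-}x=x$ for all $x$. The class of these algebras is $\mathsf{CIdInRL}$. The monoidal order is $x\sqsubseteq y :\Leftrightarrow x\cdot y=x$; it is a meet-semilattice order with meet $\cdot$. The semilattice $\langle A,\sqsubseteq\rangle$ is called distributive if for all $x,y,z\in A$ with $x\cdot y\sqsubseteq z$ there exist $x',y'\in A$ such that $x\sqsubseteq x'$, $y\sqsubseteq y'$ and $z=x'\cdot y'$. *)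

theory Defs
  imports Main
begin

class comm_residuated_lattice = lattice + comm_monoid_mult + zero +
  fixes residual :: "'a \<Rightarrow> 'a \<Rightarrow> 'a"  (infixr "\<leadsto>" 60)
  assumes residuation: "x * y \<le> z \<longleftrightarrow> y \<le> x \<leadsto> z"
begin

definition neg :: "'a \<Rightarrow> 'a"
  where "neg x = x \<leadsto> 0"

text \<open>The constant \<open>0\<close> is arbitrary: it need not be the bottom element, nor differ from \<open>1\<close>.\<close>

end

class cidinrl = comm_residuated_lattice +
  assumes mult_idem: "x * x = x"
    and neg_neg: "neg (neg x) = x"
begin

definition monoidal_le :: "'a \<Rightarrow> 'a \<Rightarrow> bool"  (infix "\<sqsubseteq>" 50)
  where "x \<sqsubseteq> y \<longleftrightarrow> x * y = x"

definition monoidal_less :: "'a \<Rightarrow> 'a \<Rightarrow> bool"  (infix "\<sqsubset>" 50)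
  where "x \<sqsubset> y \<longleftrightarrow> x \<sqsubseteq> y \<and> x \<noteq> y"

end

text \<open>
  The library locale \<^locale>\<open>semilattice_order\<close> describes a meet-semilattice together with its
  order and the associated strict order.
\<close>

locale distributive_semilattice = semilattice_order meet le less
  for meet :: "'a \<Rightarrow> 'a \<Rightarrow> 'a" and le :: "'a \<Rightarrow> 'a \<Rightarrow> bool" and less :: "'a \<Rightarrow> 'a \<Rightarrow> bool" +
  assumes distributive:
    "le (meet x y) z \<Longrightarrow> \<exists>x' y'. le x x' \<and> le y y' \<and> z = meet x' y'"

end

theory Submission
  imports Defs
begin

text \<open>
  For \<open>p \<ge> 1\<close> let \<open>B\<^sub>p\<close> be the set of all \<open>x\<close> with \<open>-(x \<cdot> -x) = p\<close>. These sets partition the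
  algebra into Boolean algebras with bounds \<open>-p\<close> and \<open>p\<close>, on which the two orders agree. Let
  \<open>x \<in> B\<^sub>p\<close>, \<open>y \<in> B\<^sub>q\<close>, \<open>z \<in> B\<^sub>r\<close> and \<open>x \<cdot> y \<sqsubseteq> z\<close>. Then \<open>r \<le> p \<cdot> q\<close>, and since the elements above
  \<open>1\<close> form a distributive lattice with join \<open>\<cdot>\<close>, \<open>r = s \<cdot> t\<close> for \<open>s = p \<and> r\<close> and \<open>t = q \<and> r\<close>.
  The least \<open>X \<in> B\<^sub>s\<close> with \<open>x \<sqsubseteq> X\<close> is \<open>x \<cdot> (p \<leadsto> s) \<or> -s\<close>; with \<open>Y \<in> B\<^sub>t\<close> defined in the same way
  from \<open>y\<close>, one finds \<open>X \<cdot> Y \<le> z\<close>. Hence \<open>z = (z \<or> X \<cdot> r) \<cdot> (z \<or> Y \<cdot> r)\<close>, and the two factors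
  are the images of elements of \<open>B\<^sub>s\<close> and \<open>B\<^sub>t\<close> under multiplication by \<open>r\<close>, because
  multiplication by \<open>r\<close> maps \<open>B\<^sub>s\<close> onto the interval \<open>[-s \<cdot> r, r]\<close> of \<open>B\<^sub>r\<close>.
\<close>

section \<open>Multiplication and joins\<close>

context comm_residuated_lattice
begin

lemma mult_left_mono': "x \<le> y \<Longrightarrow> w * x \<le> w * y"
  using residuation order_trans order_refl by blast

lemma mult_mono': "x \<le> y \<Longrightarrow> v \<le> w \<Longrightarrow> x * v \<le> y * w"
  by (metis mult_left_mono' mult.commute order_trans)

lemma mult_sup_distrib: "x * sup y z = sup (x * y) (x * z)"
proof (rule order.antisym)
  have "y \<le> x \<leadsto> sup (x * y) (x * z)" "z \<le> x \<leadsto> sup (x * y) (x * z)"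
    by (simp_all only: sup_ge1 sup_ge2 flip: residuation)
  then have "sup y z \<le> x \<leadsto> sup (x * y) (x * z)"
    by (rule sup_least)
  then show "x * sup y z \<le> sup (x * y) (x * z)"
    by (simp only: residuation)
  show "sup (x * y) (x * z) \<le> x * sup y z"
    by (simp add: mult_left_mono')
qed

lemma sup_mult_distrib: "sup y z * x = sup (y * x) (z * x)"
  using mult_sup_distrib by (simp add: mult.commute)

end

section \<open>The involution\<close>

context cidinrl
begin

lemma le_neg_iff: "x \<le> neg y \<longleftrightarrow> x * y \<le> 0"
  by (metis neg_def residuation mult.commute)

lemma le_iff_mult_neg: "x \<le> y \<longleftrightarrow> x * neg y \<le> 0"
  by (metis le_neg_iff neg_neg)

lemma neg_le_neg_iff: "neg x \<le> neg y \<longleftrightarrow> y \<le> x"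
  by (metis le_neg_iff le_iff_mult_neg mult.commute)

lemma neg_inf: "neg (inf x y) = sup (neg x) (neg y)"
proof (rule order.antisym)
  have "neg (sup (neg x) (neg y)) \<le> x" "neg (sup (neg x) (neg y)) \<le> y"
    by (metis neg_le_neg_iff neg_neg sup_ge1) (metis neg_le_neg_iff neg_neg sup_ge2)
  then show "neg (inf x y) \<le> sup (neg x) (neg y)"
    by (metis neg_le_neg_iff neg_neg le_inf_iff)
  show "sup (neg x) (neg y) \<le> neg (inf x y)"
    by (simp add: neg_le_neg_iff)
qed

lemma mult_left_idem': "x * (x * y) = x * y"
  by (metis mult.assoc mult_idem)

section \<open>Local units\<close>

text \<open>The index \<open>p\<close> of the \<open>B\<^sub>p\<close> containing \<open>x\<close>;
  by \<open>le_local_unit_iff\<close> it is the residual \<open>x \<leadsto> x\<close>.\<close>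

definition local_unit :: "'a \<Rightarrow> 'a"
  where "local_unit x = neg (x * neg x)"

lemma mult_neg_self: "x * neg x = neg (local_unit x)"
  by (simp add: local_unit_def neg_neg)

lemma le_local_unit_iff: "y \<le> local_unit x \<longleftrightarrow> y * x \<le> x"
  by (metis le_iff_mult_neg le_neg_iff local_unit_def mult.assoc)

lemma one_le_local_unit: "1 \<le> local_unit x"
  by (simp add: le_local_unit_iff)

lemma le_local_unit: "x \<le> local_unit x"
  by (simp add: le_local_unit_iff mult_idem)

lemma local_unit_neg: "local_unit (neg x) = local_unit x"
  by (simp add: local_unit_def neg_neg mult.commute)

lemma neg_local_unit_le: "neg (local_unit x) \<le> x"
  by (metis le_local_unit local_unit_neg neg_le_neg_iff neg_neg)

lemma mult_expand: "1 \<le> p \<Longrightarrow> x \<le> x * p"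
  using mult_left_mono' [of 1 p x] by simp

lemma mult_local_unit: "x * local_unit x = x"
  by (metis le_local_unit_iff mult.commute mult_expand one_le_local_unit order.antisym order_refl)

section \<open>Elements above \<open>1\<close>\<close>

lemma neg_le_zero: "1 \<le> p \<Longrightarrow> neg p \<le> 0"
  by (metis le_iff_mult_neg mult_1)

lemma local_unit_pos: "1 \<le> p \<Longrightarrow> local_unit p = p"
  by (metis le_local_unit mult_expand mult_local_unit mult.commute one_le_local_unit order.antisym)

lemma pos_mult_neg: "1 \<le> p \<Longrightarrow> p * neg p = neg p"
  by (simp add: mult_neg_self local_unit_pos)

lemma mult_neg_le_neg: "1 \<le> p \<Longrightarrow> x \<le> p \<Longrightarrow> x * neg p \<le> neg p"
  by (metis mult_mono' order_refl pos_mult_neg)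

lemma neg_le_pos: "1 \<le> p \<Longrightarrow> neg p \<le> p"
  by (metis le_iff_mult_neg mult_idem neg_le_zero)

lemma neg_mult_pos:
  assumes "1 \<le> p" "1 \<le> q"
  shows "neg p * neg q = neg (p * q)"
proof (rule order.antisym)
  have "neg p * neg q * (p * q) = (p * neg p) * (q * neg q)"
    by (simp add: ac_simps)
  also have "\<dots> \<le> 0"
    using assms by (metis mult_idem mult_mono' neg_le_zero pos_mult_neg)
  finally show "neg p * neg q \<le> neg (p * q)"
    by (simp add: le_neg_iff)
  have "neg (p * q) \<le> neg p" "neg (p * q) \<le> neg q"
    using assms by (metis mult_expand neg_le_neg_iff mult.commute)+
  then show "neg (p * q) \<le> neg p * neg q"
    by (metis mult_idem mult_mono')
qed

text \<open>Negation turns the meets into joins, over which multiplication distributes, and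
  \<open>neg_mult_pos\<close> evaluates the resulting products.\<close>

lemma pos_mult_inf:
  assumes "1 \<le> p" "1 \<le> q" "1 \<le> r" "r \<le> p * q"
  shows "inf p r * inf q r = r"
proof (rule order.antisym)
  let ?u = "inf p r * inf q r"
  show "?u \<le> r"
    by (metis inf_le2 mult_idem mult_mono')
  have pos: "1 \<le> inf p r" "1 \<le> inf q r"
    using assms by simp_all
  then have "neg ?u = neg (inf p r) * neg (inf q r)"
    by (simp add: neg_mult_pos)
  also have "\<dots> = sup (sup (neg (p * q)) (neg (p * r))) (sup (neg (r * q)) (neg r))"
    using assms by (simp add: neg_inf mult_sup_distrib sup_mult_distrib neg_mult_pos mult_idem ac_simps)
  also have "\<dots> \<le> neg r"
    using assms by (metis le_sup_iff mult.commute mult_expand neg_le_neg_iff order_refl)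
  finally show "r \<le> ?u"
    by (simp add: neg_le_neg_iff)
qed

section \<open>The Boolean components\<close>

text \<open>Membership test for \<open>B\<^sub>p\<close>: the bounds give
  \<open>neg p = neg p * neg p \<le> x * neg x\<close>, and absorbing \<open>p\<close> gives the
  other inequality.\<close>

lemma local_unit_eqI:
  assumes "1 \<le> p" "neg p \<le> x" "x \<le> p" "x * p = x"
  shows "local_unit x = p"
proof (rule order.antisym)
  have "neg p \<le> x * neg x"
    using assms by (metis mult_idem mult_mono' neg_le_neg_iff)
  then show "local_unit x \<le> p"
    by (metis local_unit_def neg_le_neg_iff neg_neg)
  show "p \<le> local_unit x"
    using assms by (simp add: le_local_unit_iff mult.commute)
qed

lemma inf_mult_surj:
  assumes "1 \<le> s" "s \<le> r" and y: "local_unit y = r" "neg s * r \<le> y"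
  shows "inf y s * r = y"
proof -
  define w where "w = inf y s * r"
  \<comment> \<open>The difference of \<open>y\<close> and \<open>w\<close> in
    \<open>B\<^sub>r\<close>. It is below \<open>y\<close> and \<open>s\<close>, hence below
    \<open>w\<close>, hence below \<open>w * neg w = neg r\<close>, the bottom.\<close>
  define d where "d = y * neg w"
  have r: "1 \<le> r"
    using assms by (metis order_trans)
  have y_r: "y * r = y" "y \<le> r"
    using y mult_local_unit le_local_unit by auto
  have "neg s \<le> inf y s"
    using assms r by (metis le_inf_iff mult_expand neg_le_pos order_trans)
  then have s_w: "neg s * r \<le> w"
    unfolding w_def by (simp add: mult_mono')
  have "neg r \<le> neg s * r"
    using assms r by (metis mult_expand neg_le_neg_iff order_trans)
  then have r_w: "neg r \<le> w"
    using s_w by simp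
  have w_y: "w \<le> y"
    unfolding w_def using y_r by (metis inf_le1 mult_mono' order_refl)
  have w_r: "w * r = w"
    unfolding w_def by (simp add: mult.assoc mult_idem)
  have "local_unit w = r"
    by (rule local_unit_eqI) (use r r_w w_y y_r w_r in auto)
  then have w_neg: "w * neg w = neg r"
    by (simp add: mult_neg_self)
  have d_r: "d * r = d"
    unfolding d_def using y_r by (metis mult.assoc mult.commute)
  have "d \<le> y"
    unfolding d_def using r_w y_r by (metis mult_mono' neg_le_neg_iff neg_neg order_refl)
  moreover have "d \<le> s"
  proof -
    have "d * neg s = y * ((neg s * r) * neg w)"
      unfolding d_def using y_r by (metis mult.assoc mult.commute)
    also have "\<dots> \<le> y * (w * neg w)"
      by (intro mult_left_mono' mult_mono' s_w order_refl)
    also have "\<dots> \<le> neg r"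
      using w_neg r y_r by (simp add: mult_neg_le_neg)
    finally show ?thesis
      using r by (metis le_iff_mult_neg neg_le_zero order_trans)
  qed
  ultimately have "d \<le> w"
    unfolding w_def using d_r by (metis le_inf_iff mult_mono' order_refl)
  then have "d * neg w \<le> neg r"
    using w_neg by (metis mult_mono' order_refl)
  moreover have "d * neg w = d"
    unfolding d_def by (simp add: mult.assoc mult_idem)
  ultimately have "y * neg w \<le> 0"
    using r unfolding d_def by (metis neg_le_zero order_trans)
  then show ?thesis
    using w_y by (metis le_iff_mult_neg order.antisym w_def)
qed

section \<open>Lifting between components\<close>

text \<open>The left adjoint of the map \<open>v \<mapsto> v \<cdot> p\<close> from \<open>B\<^sub>s\<close> to \<open>B\<^sub>p\<close>, where \<open>p\<close> is the local unit of \<open>x\<close>.\<close>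

definition lift :: "'a \<Rightarrow> 'a \<Rightarrow> 'a"
  where "lift s x = sup (x * neg (local_unit x * neg s)) (neg s)"

text \<open>The second factor is the residual \<open>local_unit x \<leadsto> s\<close>, and
  \<open>x \<le> local_unit x\<close>.\<close>

lemma mult_neg_mult_neg_le: "x * neg (local_unit x * neg s) \<le> s"
proof -
  have "x * neg (local_unit x * neg s) * neg s
      = x * ((local_unit x * neg s) * neg (local_unit x * neg s))"
    by (metis mult.assoc mult.commute mult_local_unit)
  also have "\<dots> \<le> local_unit x * ((local_unit x * neg s) * neg (local_unit x * neg s))"
    by (simp add: mult_mono' le_local_unit)
  also have "\<dots> = (local_unit x * neg s) * neg (local_unit x * neg s)"
    by (simp add: mult_left_idem' mult.assoc)
  also have "\<dots> \<le> 0"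
    by (simp add: mult_neg_self neg_le_zero one_le_local_unit)
  finally show ?thesis
    by (rule le_iff_mult_neg [THEN iffD2])
qed

lemma neg_le_lift: "neg s \<le> lift s x"
  by (simp add: lift_def)

lemma lift_le: "1 \<le> s \<Longrightarrow> lift s x \<le> s"
  by (simp add: lift_def mult_neg_mult_neg_le neg_le_pos)

text \<open>With the bounds \<open>neg_le_lift\<close> and \<open>lift_le\<close>, this puts
  \<open>lift s x\<close> into \<open>B\<^sub>s\<close>.\<close>

lemma lift_mult:
  assumes "1 \<le> s" "s \<le> local_unit x"
  shows "lift s x * s = lift s x"
proof -
  have "x * s = x"
    using assms by (metis le_local_unit_iff mult.commute mult_expand order.antisym)
  then have "x * neg (local_unit x * neg s) * s = x * neg (local_unit x * neg s)"
    by (metis mult.assoc mult.commute)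
  moreover have "neg s * s = neg s"
    using assms pos_mult_neg by (simp add: mult.commute)
  ultimately show ?thesis
    by (simp add: lift_def sup_mult_distrib)
qed

lemma local_unit_eq_sup: "local_unit x = sup x (neg x)"
proof (rule order.antisym)
  have "inf x (neg x) \<le> x * neg x"
    by (metis inf_le1 inf_le2 mult_idem mult_mono')
  then have "neg (x * neg x) \<le> neg (inf x (neg x))"
    by (simp add: neg_le_neg_iff)
  then show "local_unit x \<le> sup x (neg x)"
    by (simp add: local_unit_def neg_inf neg_neg sup.commute)
  show "sup x (neg x) \<le> local_unit x"
    by (metis le_local_unit local_unit_neg le_sup_iff)
qed

lemma mult_lift:
  assumes "1 \<le> s" "s \<le> local_unit x"
  shows "x * lift s x = x"
proof -
  define p where "p = local_unit x"
  \<comment> \<open>The bottom of \<open>B\<^sub>s\<close> carried into \<open>B\<^sub>p\<close>. As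
    \<open>x * neg s = x * e\<close>, the product \<open>x * lift s x\<close> becomes
    \<open>x * sup e (neg e) = x * p\<close>.\<close>
  define e where "e = p * neg s"
  have p: "1 \<le> p" and x_p: "x * p = x" and s: "s \<le> p"
    using one_le_local_unit mult_local_unit assms by (auto simp: p_def)
  have "neg p \<le> neg s"
    using s by (simp add: neg_le_neg_iff)
  then have e1: "neg p \<le> e"
    unfolding e_def using mult_expand [OF p, of "neg s"] by (simp add: mult.commute)
  have "neg s \<le> p"
    using assms(1) s neg_le_pos order_trans by blast
  then have e2: "e \<le> p"
    unfolding e_def by (metis mult_idem mult_left_mono')
  have "e * p = e"
    unfolding e_def by (metis mult.commute mult_left_idem')
  with p e1 e2 have "local_unit e = p"
    by (rule local_unit_eqI)
  then have sup_e: "sup e (neg e) = p"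
    by (simp add: local_unit_eq_sup)
  have "x * neg s = x * e"
    unfolding e_def using x_p by (metis mult.assoc)
  then have "x * lift s x = x * sup e (neg e)"
    unfolding lift_def p_def [symmetric] e_def [symmetric]
    by (simp add: mult_sup_distrib mult_left_idem' sup.commute)
  then show ?thesis
    using sup_e x_p by simp
qed

section \<open>The product of two lifts\<close>

text \<open>Bounds the mixed terms in the product of two lifts. By contraposition it suffices that
  \<open>a * neg z\<close> is below both local units.\<close>

lemma mult_neg_inf_le:
  assumes "a \<le> local_unit z" "a * y * z = a * y"
  shows "a * neg (inf (local_unit y) (local_unit z)) \<le> z"
proof -
  define q where "q = local_unit y"
  define r where "r = local_unit z"
  have q: "1 \<le> q" and r: "1 \<le> r"
    by (simp_all add: q_def r_def one_le_local_unit)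
  have a_r: "a \<le> r"
    using assms by (simp add: r_def)
  have y_q: "y * neg q = neg q"
    unfolding q_def by (metis mult_neg_self mult_left_idem')
  have z_r: "z * neg z = neg r"
    unfolding r_def by (rule mult_neg_self)
  have "neg z \<le> r"
    by (metis le_local_unit local_unit_neg r_def)
  then have g_r: "a * neg z \<le> r"
    using a_r by (metis mult_idem mult_mono')
  \<comment> \<open>Since \<open>neg q\<close> absorbs \<open>y\<close>, a factor \<open>y\<close>
    can be inserted; then \<open>a * y\<close> supplies a \<open>z\<close>, and
    \<open>z * neg z\<close> collapses to \<open>neg r\<close>.\<close>
  have "a * neg z * neg q = (a * y) * (neg q * neg z)"
    using y_q by (metis mult.assoc mult.commute)
  also have "\<dots> = (a * y * z) * (neg q * neg z)"
    using assms by simp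
  also have "\<dots> = a * (z * neg z) * (y * neg q)"
    by (simp add: ac_simps)
  also have "\<dots> = a * neg r * neg q"
    by (simp add: y_q z_r)
  also have "\<dots> \<le> neg r * neg q"
    by (intro mult_mono' mult_neg_le_neg order_refl r a_r)
  also have "\<dots> \<le> 0"
    by (metis mult_idem mult_mono' neg_le_zero q r)
  finally have "a * neg z \<le> q"
    by (rule le_iff_mult_neg [THEN iffD2])
  with g_r have "a * neg z * neg (inf q r) \<le> 0"
    by (metis le_iff_mult_neg le_inf_iff)
  then show ?thesis
    by (metis le_iff_mult_neg mult.assoc mult.commute q_def r_def)
qed

lemma local_unit_mult: "local_unit (x * y) = local_unit x * local_unit y"
proof (rule local_unit_eqI)
  show "1 \<le> local_unit x * local_unit y"
    by (metis mult_expand one_le_local_unit order_trans)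
  show "neg (local_unit x * local_unit y) \<le> x * y"
    by (simp add: mult_mono' neg_local_unit_le one_le_local_unit flip: neg_mult_pos)
  show "x * y \<le> local_unit x * local_unit y"
    by (simp add: le_local_unit mult_mono')
  have "x * y * (local_unit x * local_unit y) = (x * local_unit x) * (y * local_unit y)"
    by (simp add: ac_simps)
  then show "x * y * (local_unit x * local_unit y) = x * y"
    by (simp add: mult_local_unit)
qed

text \<open>Expanding the joins leaves four terms. The mixed ones fall under
  \<open>mult_neg_inf_le\<close>, \<open>neg s * neg t\<close> is the bottom of the component of
  \<open>z\<close>, and \<open>a * b\<close> absorbs \<open>z\<close> and is below
  \<open>local_unit z\<close>.\<close>

lemma lift_mult_lift_le:
  fixes x y z
  defines "s \<equiv> inf (local_unit x) (local_unit z)"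
    and "t \<equiv> inf (local_unit y) (local_unit z)"
  assumes "x * y * z = x * y" and st: "s * t = local_unit z"
  shows "lift s x * lift t y \<le> z"
proof -
  define a where "a = x * neg (local_unit x * neg s)"
  define b where "b = y * neg (local_unit y * neg t)"
  have z: "1 \<le> local_unit z"
    by (rule one_le_local_unit)
  have s: "1 \<le> s" "s \<le> local_unit z" and t: "1 \<le> t" "t \<le> local_unit z"
    by (simp_all add: s_def t_def one_le_local_unit)
  have a: "a \<le> s" and b: "b \<le> t"
    by (simp_all add: a_def b_def mult_neg_mult_neg_le)
  have xyz: "x * (y * z) = x * y" "y * (x * z) = y * x"
    using assms by (simp_all add: ac_simps)
  have "a * y * z = x * (y * z) * neg (local_unit x * neg s)"
    by (simp add: a_def ac_simps)
  also have "\<dots> = a * y"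
    unfolding xyz by (simp add: a_def ac_simps)
  finally have ayz: "a * y * z = a * y" .
  have "b * x * z = y * (x * z) * neg (local_unit y * neg t)"
    by (simp add: b_def ac_simps)
  also have "\<dots> = b * x"
    unfolding xyz by (simp add: b_def ac_simps)
  finally have bxz: "b * x * z = b * x" .
  have "a * b * z = a * y * z * neg (local_unit y * neg t)"
    by (simp add: b_def ac_simps)
  also have "\<dots> = a * b"
    unfolding ayz by (simp add: b_def ac_simps)
  finally have "a * b * neg z = a * b * (z * neg z)"
    by (metis mult.assoc)
  also have "\<dots> = a * b * neg (local_unit z)"
    by (simp add: mult_neg_self)
  also have "\<dots> \<le> neg (local_unit z)"
    using a b st z by (metis mult_mono' mult_neg_le_neg)
  finally have 1: "a * b \<le> z"
    using neg_le_zero [OF z] le_iff_mult_neg order_trans by blast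
  have 2: "a * neg t \<le> z"
    unfolding t_def using a s ayz by (intro mult_neg_inf_le) auto
  have 3: "neg s * b \<le> z"
    unfolding s_def using b t bxz mult_neg_inf_le [of b z x] by (simp add: mult.commute)
  have 4: "neg s * neg t \<le> z"
    using s t st by (simp add: neg_mult_pos neg_local_unit_le)
  show ?thesis
    unfolding lift_def a_def [symmetric] b_def [symmetric]
    using 1 2 3 4 by (simp add: mult_sup_distrib sup_mult_distrib)
qed

section \<open>Factoring \<open>z\<close>\<close>

text \<open>Follows the pattern \<open>(z \<or> u) \<and> (z \<or> v) = z \<or> (u \<and> v)\<close>
  with multiplication as meet; the cross terms are below \<open>z * r = z\<close>.\<close>

lemma sup_mult_sup:
  assumes "u \<le> r" "v \<le> r" "z * r = z" "u * v \<le> z"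
  shows "sup z u * sup z v = z"
proof (rule order.antisym)
  have "z * u \<le> z" "z * v \<le> z"
    using assms by (metis mult_left_mono')+
  then show "sup z u * sup z v \<le> z"
    using assms by (simp add: mult_sup_distrib sup_mult_distrib mult_idem mult.commute)
  show "z \<le> sup z u * sup z v"
    by (metis mult_idem mult_mono' sup_ge1)
qed

text \<open>Pulls one factor of \<open>z\<close> back along multiplication by
  \<open>local_unit z\<close>. It serves both sides: \<open>k\<close>, \<open>w\<close> stand for
  \<open>s\<close>, \<open>x\<close> and for \<open>t\<close>, \<open>y\<close>.\<close>

lemma ex_factor:
  fixes k w z
  defines "u \<equiv> lift k w * local_unit z"
  assumes "1 \<le> k" "k \<le> local_unit w" "k \<le> local_unit z"
  shows "\<exists>w'. w * w' = w \<and> w' * k = w' \<and> w' * local_unit z = sup z u"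
proof -
  define r where "r = local_unit z"
  define m where "m = sup z u"
  define w' where "w' = inf m k"
  have r: "1 \<le> r" and k: "1 \<le> k" "k \<le> local_unit w" "k \<le> r"
    using assms by (simp_all add: r_def one_le_local_unit)
  have z_r: "z * r = z" "z \<le> r" "neg r \<le> z"
    by (simp_all add: r_def mult_local_unit le_local_unit neg_local_unit_le)
  have u: "u = lift k w * r"
    by (simp add: u_def r_def)
  have "u \<le> r"
    unfolding u using k lift_le by (metis mult_idem mult_mono' order_refl order_trans)
  then have m: "neg r \<le> m" "m \<le> r" "m * r = m"
    using z_r by (simp_all add: m_def u sup_mult_distrib mult.assoc mult_idem le_supI1)
  with r have "local_unit m = r"
    by (rule local_unit_eqI)
  moreover have "neg k * r \<le> m"
    by (simp add: m_def u le_supI2 mult_mono' neg_le_lift)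
  ultimately have w'_r: "w' * r = m"
    unfolding w'_def using k by (intro inf_mult_surj)
  have w'_k: "w' * k = w'"
  proof (rule order.antisym)
    have "w' * k \<le> m * r" "w' * k \<le> k * k"
      unfolding w'_def using k by (intro mult_mono'; simp)+
    then show "w' * k \<le> w'"
      using m by (simp add: w'_def mult_idem)
    show "w' \<le> w' * k"
      using k by (simp add: mult_expand)
  qed
  \<comment> \<open>The preimage stays above the lift, so
    \<open>w \<sqsubseteq> lift k w \<sqsubseteq> w'\<close>.\<close>
  have "lift k w \<le> m"
    unfolding m_def u using mult_expand [OF r] le_supI2 by blast
  then have lift_le_w': "lift k w \<le> w'"
    using k by (simp add: lift_le w'_def)
  have "lift k w * w' = lift k w"
  proof (rule order.antisym)
    show "lift k w * w' \<le> lift k w"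
      unfolding w'_def using k by (metis inf_le2 lift_mult mult_left_mono')
    show "lift k w \<le> lift k w * w'"
      using lift_le_w' by (metis mult_idem mult_left_mono')
  qed
  then have "w * w' = w"
    using k by (metis mult_lift mult.assoc)
  then show ?thesis
    using w'_k w'_r unfolding m_def r_def by blast
qed

lemma mult_factor:
  assumes "x * y * z = x * y"
  shows "\<exists>x' y'. x * x' = x \<and> y * y' = y \<and> z = x' * y'"
proof -
  define r where "r = local_unit z"
  define s where "s = inf (local_unit x) r"
  define t where "t = inf (local_unit y) r"
  have pos: "1 \<le> r" "1 \<le> s" "1 \<le> t"
    by (simp_all add: r_def s_def t_def one_le_local_unit)
  have st_le: "s \<le> local_unit x" "s \<le> r" "t \<le> local_unit y" "t \<le> r"
    by (simp_all add: s_def t_def)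
  have z_r: "z * r = z"
    by (simp add: r_def mult_local_unit)
  \<comment> \<open>\<open>x * y\<close> inherits from \<open>z\<close> that it absorbs
    \<open>r\<close>, which bounds \<open>r\<close> by the local unit of
    \<open>x * y\<close>.\<close>
  have "r * (x * y) = x * y"
    using assms z_r by (metis mult.assoc mult.commute)
  then have "r \<le> local_unit x * local_unit y"
    by (simp add: le_local_unit_iff flip: local_unit_mult)
  then have st: "s * t = r"
    unfolding s_def t_def using pos by (intro pos_mult_inf one_le_local_unit)
  define u where "u = lift s x * r"
  define v where "v = lift t y * r"
  obtain x' where x': "x * x' = x" "x' * s = x'" "x' * r = sup z u"
    using ex_factor [of s x z] pos st_le unfolding u_def r_def by blast
  obtain y' where y': "y * y' = y" "y' * t = y'" "y' * r = sup z v"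
    using ex_factor [of t y z] pos st_le unfolding v_def r_def by blast
  have "u \<le> r" "v \<le> r"
    unfolding u_def v_def using pos st_le lift_le by (metis mult_idem mult_mono' order_refl order_trans)+
  moreover have "u * v \<le> z"
  proof -
    have "u * v = lift s x * lift t y * r"
      unfolding u_def v_def by (metis mult.assoc mult.commute mult_idem)
    also have "\<dots> \<le> z * r"
      using lift_mult_lift_le [of x y z] assms st
      by (intro mult_mono' order_refl) (simp add: s_def t_def r_def)
    finally show ?thesis
      by (simp add: z_r)
  qed
  ultimately have "z = (x' * r) * (y' * r)"
    unfolding x'(3) y'(3) using z_r by (intro sup_mult_sup [symmetric])
  also have "\<dots> = (x' * s) * (y' * t) * r"
    unfolding x'(2) y'(2) by (metis mult.assoc mult.commute mult_idem)
  \<comment> \<open>The extra factor \<open>r\<close> is \<open>s * t\<close>, already present on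
    the left.\<close>
  also have "\<dots> = (x' * s) * (y' * t)"
    unfolding st [symmetric] by (simp add: ac_simps mult_idem mult_left_idem')
  finally have "z = x' * y'"
    unfolding x'(2) y'(2) .
  then show ?thesis
    using x'(1) y'(1) by blast
qed

end

theorem theorem7p2:
  shows "distributive_semilattice ((*) :: 'a::{finite, cidinrl} \<Rightarrow> 'a \<Rightarrow> 'a) (\<sqsubseteq>) (\<sqsubset>)"
proof
  show "\<exists>x' y'. x \<sqsubseteq> x' \<and> y \<sqsubseteq> y' \<and> z = x' * y'" if "x * y \<sqsubseteq> z" for x y z :: 'a
    using that mult_factor [of x y z] unfolding monoidal_le_def by blast
qed (auto simp: monoidal_le_def monoidal_less_def mult_idem ac_simps)

end
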